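(* Let $m\ge2$ be an integer, $G$ a path-connected group-like space and $X$ an ANR. Then the set $[X^m,G]':=\{f\in[X^m,G]\mid f|_{\Delta_mX}\simeq *\}$, where $\Delta_m\colon X\to X^m$ is the diagonal map, is a nilpotent group of nilpotency class $$c([X^m,G]')\le\mathsf{TC}_m(X).$$
   Context: A group-like space is a homotopy-associative $H$-space $G$ with multiplication $\mu\colon G\times G\to G$, identity $e$ (with $\mu|_{G\times\{e\}}\simeq\mathrm{id}_G\simeq\mu|_{\{e\}\times G}$), and an inversion $\eta\colon G\to G$ with $\mu\circ(\mathrm{id}\times\eta)\circ\Delta\simeq c_e\simeq\mu\circ(\eta\times\mathrm{id})\circ\Delta$, where $c_e$ is the constant map at $e$ and $\Delta\colon G\to G\times G$ the diagonal. $[X^m,G]$ is the set of homotopy classes of maps, with group structure $[\alpha]\cdot[\beta]=[\mu\circ(\alpha,\beta)]$ and $[\alpha]^{-1}=[\eta\circ\alpha]$, restricted to $[X^m,G]'$. $\Delta_mX\subset X^m$ is the image of $\Delta_m$. $\mathsf{TC}_m(X)$ is the $m$-th sequential topological complexity (normalized): with fixed times $0=t_1<\dots<t_m=1$, it is the least $n\ge0$ such that $X^m$ is covered by $n+1$ open sets over each of which the fibration $\pi^X_m\colon X^I\to X^m$, $\gamma\mapsto(\gamma(t_1),\dots,\gamma(t_m))$, has a continuous partial section. The nilpotency class $c(H)$ of a nilpotent group $H$ is the smallest $c$ for which there is a central series $H=\Gamma_1\trianglerighteq\dots\trianglerighteq\Gamma_{c+1}=\{1\}$, i.e. $hkh^{-1}k^{-1}\in\Gamma_{i+1}$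 for all $h\in H$, $k\in\Gamma_i$.
   Formalization: Nilpotency of [X^m,G]' is asserted only when TC_m(X) is finite; if no finite cover exists (TC_m(X) infinite), only that it is a group is claimed, since nilpotency can fail there, e.g. for X a disjoint union of tori T^n and G the loop space of S^2 v S^2. *)

theory Defs
  imports "HOL-Analysis.Analysis" "HOL-Algebra.Coset"
begin

text \<open>Spaces are topologies in the sense of HOL-Analysis, with an explicit carrier
  \<open>topspace\<close>. The library predicate \<open>ANR\<close> only concerns subsets of a type class and only tests
  closed copies inside \<open>'a \<times> real\<close>, which is adequate for Euclidean spaces but not in general.
  Below is the usual notion for metrizable spaces: \<open>X\<close> is a neighbourhood retract of every
  metrizable space \<open>Z\<close> containing a closed copy of it.
  Since HOL cannot quantify over types inside a formula, \<open>Z\<close> ranges over all metrizable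
  topologies with points in \<open>'a \<Rightarrow> real\<close>. Nothing is lost: by the Kuratowski-Wojdyslawski
  embedding, \<open>X\<close> is closed in the convex hull of its image in the normed space of bounded
  functions on \<open>X\<close>, a space of this kind that is an absolute extensor by Dugundji's theorem;
  if \<open>X\<close> is a neighbourhood retract there, it is one in every metrizable space of any type.\<close>

definition metrizable_ANR :: "'a topology \<Rightarrow> bool" where
  "metrizable_ANR X \<longleftrightarrow>
     metrizable_space X \<and>
     (\<forall>(Z :: ('a \<Rightarrow> real) topology) A.
        metrizable_space Z \<and> closedin Z A \<and> X homeomorphic_space subtopology Z A \<longrightarrow>
        (\<exists>W. openin Z W \<and> A retract_of_space subtopology Z W))"

text \<open>All homotopies are free, i.e. not required to preserve base points.\<close>

definition group_like_space ::
    "'b topology \<Rightarrow> ('b \<times> 'b \<Rightarrow> 'b) \<Rightarrow> 'b \<Rightarrow> ('b \<Rightarrow> 'b) \<Rightarrow> bool" where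
  "group_like_space G \<mu> e \<eta> \<longleftrightarrow>
     e \<in> topspace G \<and>
     continuous_map (prod_topology G G) G \<mu> \<and>
     continuous_map G G \<eta> \<and>
     homotopic_with (\<lambda>_. True) (prod_topology (prod_topology G G) G) G
       (\<lambda>((x, y), z). \<mu> (\<mu> (x, y), z)) (\<lambda>((x, y), z). \<mu> (x, \<mu> (y, z))) \<and>
     homotopic_with (\<lambda>_. True) G G (\<lambda>x. \<mu> (x, e)) (\<lambda>x. x) \<and>
     homotopic_with (\<lambda>_. True) G G (\<lambda>x. \<mu> (e, x)) (\<lambda>x. x) \<and>
     homotopic_with (\<lambda>_. True) G G (\<lambda>x. \<mu> (x, \<eta> x)) (\<lambda>_. e) \<and>
     homotopic_with (\<lambda>_. True) G G (\<lambda>x. \<mu> (\<eta> x, x)) (\<lambda>_. e)"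

definition homotopy_class :: "'a topology \<Rightarrow> 'b topology \<Rightarrow> ('a \<Rightarrow> 'b) \<Rightarrow> ('a \<Rightarrow> 'b) set" where
  "homotopy_class Y G f = {g. homotopic_with (\<lambda>_. True) Y G f g}"

definition homotopy_classes :: "'a topology \<Rightarrow> 'b topology \<Rightarrow> ('a \<Rightarrow> 'b) set set" where
  "homotopy_classes Y G = homotopy_class Y G ` {f. continuous_map Y G f}"

text \<open>The structure on \<open>[Y, G]\<close>. The product is given by
  \<open>[\<alpha>] \<cdot> [\<beta>] = [\<mu> \<circ> (\<alpha>, \<beta>)]\<close>; the union is over equal sets, one for each choice of
  representatives. Inverses are part of the assertion that this is a group.\<close>

definition homotopy_group ::
    "'a topology \<Rightarrow> 'b topology \<Rightarrow> ('b \<times> 'b \<Rightarrow> 'b) \<Rightarrow> 'b \<Rightarrow> ('a \<Rightarrow> 'b) set monoid" where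
  "homotopy_group Y G \<mu> e =
     \<lparr>carrier = homotopy_classes Y G,
      mult = (\<lambda>A B. \<Union>\<alpha>\<in>A. \<Union>\<beta>\<in>B. homotopy_class Y G (\<lambda>x. \<mu> (\<alpha> x, \<beta> x))),
      one = homotopy_class Y G (\<lambda>_. e)\<rparr>"

definition nullhomotopic_on :: "'a topology \<Rightarrow> 'a set \<Rightarrow> 'b topology \<Rightarrow> ('a \<Rightarrow> 'b) \<Rightarrow> bool" where
  "nullhomotopic_on Y D G f \<longleftrightarrow>
     (\<exists>c\<in>topspace G. homotopic_with (\<lambda>_. True) (subtopology Y D) G f (\<lambda>_. c))"

abbreviation cartesian_power :: "nat \<Rightarrow> 'a topology \<Rightarrow> (nat \<Rightarrow> 'a) topology" where
  "cartesian_power m X \<equiv> product_topology (\<lambda>_. X) {1..m}"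

definition diagonal :: "nat \<Rightarrow> 'a topology \<Rightarrow> (nat \<Rightarrow> 'a) set" where
  "diagonal m X = (\<lambda>x. \<lambda>i\<in>{1..m}. x) ` topspace X"

text \<open>The group \<open>[X\<^sup>m, G]'\<close> of classes that are nullhomotopic on the diagonal.\<close>

definition diagonal_null_group ::
    "nat \<Rightarrow> 'a topology \<Rightarrow> 'b topology \<Rightarrow> ('b \<times> 'b \<Rightarrow> 'b) \<Rightarrow> 'b \<Rightarrow> ((nat \<Rightarrow> 'a) \<Rightarrow> 'b) set monoid"
  where
  "diagonal_null_group m X G \<mu> e =
     (homotopy_group (cartesian_power m X) G \<mu> e)
       \<lparr>carrier := homotopy_class (cartesian_power m X) G `
          {f. continuous_map (cartesian_power m X) G f \<and>
              nullhomotopic_on (cartesian_power m X) (diagonal m X) G f}\<rparr>"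

text \<open>Points of the mapping space are extensional on \<open>topspace Y\<close>, so that they correspond
  exactly to continuous maps \<open>Y \<rightarrow> Z\<close>. Its carrier is the subbasic set for \<open>K = {}\<close>.\<close>

definition compact_open_topology :: "'a topology \<Rightarrow> 'b topology \<Rightarrow> ('a \<Rightarrow> 'b) topology" where
  "compact_open_topology Y Z =
     topology_generated_by
       {{f \<in> extensional (topspace Y). continuous_map Y Z f \<and> f ` K \<subseteq> U} | K U.
          compactin Y K \<and> openin Z U}"

definition path_space :: "'a topology \<Rightarrow> (real \<Rightarrow> 'a) topology" where
  "path_space X = compact_open_topology (top_of_set {0..1}) X"

definition path_evaluation :: "nat \<Rightarrow> (nat \<Rightarrow> real) \<Rightarrow> (real \<Rightarrow> 'a) \<Rightarrow> nat \<Rightarrow> 'a" where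
  "path_evaluation m t \<gamma> = (\<lambda>i\<in>{1..m}. \<gamma> (t i))"

definition has_motion_section ::
    "nat \<Rightarrow> (nat \<Rightarrow> real) \<Rightarrow> 'a topology \<Rightarrow> (nat \<Rightarrow> 'a) set \<Rightarrow> bool" where
  "has_motion_section m t X U \<longleftrightarrow>
     (\<exists>s. continuous_map (subtopology (cartesian_power m X) U) (path_space X) s \<and>
          (\<forall>x\<in>U. path_evaluation m t (s x) = x))"

text \<open>The value is \<open>\<infinity>\<close> (the infimum of the empty set) if no finite cover exists.\<close>

definition sequential_TC :: "nat \<Rightarrow> (nat \<Rightarrow> real) \<Rightarrow> 'a topology \<Rightarrow> enat" where
  "sequential_TC m t X =
     Inf {enat n | n. \<exists>U :: nat \<Rightarrow> (nat \<Rightarrow> 'a) set.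
            (\<forall>i\<le>n. openin (cartesian_power m X) (U i) \<and> has_motion_section m t X (U i)) \<and>
            (\<Union>i\<le>n. U i) = topspace (cartesian_power m X)}"

definition is_central_series :: "('a, 'b) monoid_scheme \<Rightarrow> nat \<Rightarrow> (nat \<Rightarrow> 'a set) \<Rightarrow> bool" where
  "is_central_series H c \<Gamma> \<longleftrightarrow>
     \<Gamma> 1 = carrier H \<and> \<Gamma> (c + 1) = {\<one>\<^bsub>H\<^esub>} \<and>
     (\<forall>i\<in>{1..c}. \<Gamma> (i + 1) \<lhd> H\<lparr>carrier := \<Gamma> i\<rparr> \<and>
        (\<forall>h\<in>carrier H. \<forall>k\<in>\<Gamma> i.
           h \<otimes>\<^bsub>H\<^esub> k \<otimes>\<^bsub>H\<^esub> inv\<^bsub>H\<^esub> h \<otimes>\<^bsub>H\<^esub> inv\<^bsub>H\<^esub> k \<in> \<Gamma> (i + 1)))"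

definition nilpotent_group :: "('a, 'b) monoid_scheme \<Rightarrow> bool" where
  "nilpotent_group H \<longleftrightarrow> group H \<and> (\<exists>c \<Gamma>. is_central_series H c \<Gamma>)"

text \<open>With the convention that a group which is not nilpotent has class \<open>\<infinity>\<close>.\<close>

definition nilpotency_class :: "('a, 'b) monoid_scheme \<Rightarrow> enat" where
  "nilpotency_class H = Inf {enat c | c. \<exists>\<Gamma>. is_central_series H c \<Gamma>}"

end

theory Submission
  imports Defs
begin

text \<open>
  Write \<open>Y = X\<^sup>m\<close>. For a subset \<open>W\<close> of \<open>Y\<close> let \<open>N(W)\<close> be the set of classes in \<open>[Y, G]\<close> whose
  restriction to \<open>W\<close> is homotopic to the constant map at \<open>e\<close>. It is the kernel of the restriction
  homomorphism \<open>[Y, G] \<rightarrow> [W, G]\<close>, hence a normal subgroup, and since \<open>G\<close> is path-connected the group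
  of the theorem is \<open>N(\<Delta>)\<close> for the diagonal \<open>\<Delta>\<close>. Two facts carry the proof.

  A motion planner over \<open>U\<close> deforms the inclusion \<open>U \<rightarrow> Y\<close> into the diagonal: run all \<open>m\<close> coordinates
  backwards along the planned path to its starting point
  (\<open>motion_section_deforms_into_diagonal\<close>). Therefore \<open>N(\<Delta>) \<subseteq> N(U)\<close>.

  If \<open>U\<close> and \<open>V\<close> are open, \<open>A\<close> lies in \<open>N(U)\<close> and \<open>B\<close> in \<open>N(V)\<close>, then the commutator of \<open>A\<close> and \<open>B\<close>
  lies in \<open>N(U \<union> V)\<close> (\<open>commutator_in_null_classes_union\<close>). This is the classical argument of
  G. W. Whitehead: representatives can be made constant on slightly smaller sets that still cover
  \<open>U \<union> V\<close>, and the commutator map \<open>G \<times> G \<rightarrow> G\<close> is nullhomotopic on either axis. The two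
  nullhomotopies need not agree at the point \<open>(e, e)\<close> common to the axes, and \<open>(G, e)\<close> need not have
  the homotopy extension property. Instead of matching them, they are applied with speeds governed by
  an Urysohn function \<open>l\<close>; what is left of the commutator is a path in \<open>G\<close> composed with \<open>l\<close>, which is
  nullhomotopic because the real line is contractible (\<open>nullhomotopic_on_union\<close>).

  Given motion planners over open sets \<open>U\<^sub>0, \<dots>, U\<^sub>n\<close> that cover \<open>Y\<close>, the groups
  \<open>N(\<Delta>) \<inter> N(U\<^sub>0 \<union> \<dots> \<union> U\<^bsub>i-1\<^esub>)\<close> for \<open>i = 1, \<dots>, n + 1\<close> form a central series: the first is \<open>N(\<Delta>)\<close> by the
  first fact, the last is \<open>N(Y) = 1\<close>, and successive ones are linked by the second fact
  (\<open>central_series_of_open_cover\<close>).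
\<close>

section \<open>Homotopy classes of maps into a group-like space\<close>

abbreviation homotopic_maps :: "'a topology \<Rightarrow> 'b topology \<Rightarrow> ('a \<Rightarrow> 'b) \<Rightarrow> ('a \<Rightarrow> 'b) \<Rightarrow> bool" where
  "homotopic_maps \<equiv> homotopic_with (\<lambda>_. True)"

lemma homotopic_maps_paired:
  assumes "homotopic_maps Y Z f f'" and "homotopic_maps Y Z' g g'"
  shows "homotopic_maps Y (prod_topology Z Z') (\<lambda>x. (f x, g x)) (\<lambda>x. (f' x, g' x))"
proof -
  obtain h where h: "continuous_map (prod_topology (top_of_set {0..1::real}) Y) Z h"
      "\<And>x. h (0, x) = f x" "\<And>x. h (1, x) = f' x"
    using assms(1) by (auto simp: homotopic_with_def)
  obtain k where k: "continuous_map (prod_topology (top_of_set {0..1::real}) Y) Z' k"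
      "\<And>x. k (0, x) = g x" "\<And>x. k (1, x) = g' x"
    using assms(2) by (auto simp: homotopic_with_def)
  show ?thesis
    unfolding homotopic_with_def
    by (rule exI[of _ "\<lambda>p. (h p, k p)"]) (use h k in \<open>auto intro: continuous_map_pairedI\<close>)
qed

lemma homotopic_maps_left:
  "homotopic_maps Y Z f g \<Longrightarrow> continuous_map Z Z' p \<Longrightarrow> homotopic_maps Y Z' (\<lambda>x. p (f x)) (\<lambda>x. p (g x))"
  using homotopic_with_compose_continuous_map_left[of "\<lambda>_. True" Y Z f g Z' p "\<lambda>_. True"]
  by (simp add: o_def)

lemma homotopic_maps_right:
  "homotopic_maps Y Z f g \<Longrightarrow> continuous_map Y' Y p \<Longrightarrow> homotopic_maps Y' Z (\<lambda>x. f (p x)) (\<lambda>x. g (p x))"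
  using homotopic_with_compose_continuous_map_right[of "\<lambda>_. True" Y Z f g Y' p "\<lambda>_. True"]
  by (simp add: o_def)

lemma homotopic_maps_constant:
  assumes "path_connected_space G" "a \<in> topspace G" "b \<in> topspace G"
  shows "homotopic_maps Y G (\<lambda>_. a) (\<lambda>_. b)"
  using assms by (simp add: homotopic_constant_maps path_connected_space_iff_path_component)

lemma mem_homotopy_class_self: "continuous_map Y G f \<Longrightarrow> f \<in> homotopy_class Y G f"
  by (simp add: homotopy_class_def)

lemma homotopy_class_eq_iff:
  assumes "continuous_map Y G f"
  shows "homotopy_class Y G f = homotopy_class Y G g \<longleftrightarrow> homotopic_maps Y G f g"
proof
  assume eq: "homotopy_class Y G f = homotopy_class Y G g"
  show "homotopic_maps Y G f g"
    using mem_homotopy_class_self[OF assms] unfolding eq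
    by (simp add: homotopy_class_def homotopic_with_sym)
next
  assume "homotopic_maps Y G f g"
  then show "homotopy_class Y G f = homotopy_class Y G g"
    unfolding homotopy_class_def
    by (blast intro: homotopic_with_trans homotopic_with_symD)
qed

text \<open>Operations on classes are written as unions over all representatives. This collapses such a union
  once the operation is known to respect homotopy.\<close>

lemma UN_homotopy_class_const:
  assumes "continuous_map Y G f" and "\<And>g. homotopic_maps Y G f g \<Longrightarrow> T g = S"
  shows "(\<Union>g\<in>homotopy_class Y G f. T g) = S"
  using mem_homotopy_class_self[OF assms(1)] assms(2) unfolding homotopy_class_def by blast

definition restrict_class :: "'a topology \<Rightarrow> 'b topology \<Rightarrow> 'a set \<Rightarrow> ('a \<Rightarrow> 'b) set \<Rightarrow> ('a \<Rightarrow> 'b) set" where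
  "restrict_class Y G W A = (\<Union>f\<in>A. homotopy_class (subtopology Y W) G f)"

lemma restrict_class_homotopy_class:
  assumes "continuous_map Y G f"
  shows "restrict_class Y G W (homotopy_class Y G f) = homotopy_class (subtopology Y W) G f"
  unfolding restrict_class_def
proof (rule UN_homotopy_class_const[OF assms])
  fix g assume "homotopic_maps Y G f g"
  then have "homotopic_maps (subtopology Y W) G g f"
    by (intro homotopic_from_subtopology) (simp add: homotopic_with_sym)
  moreover from this have "continuous_map (subtopology Y W) G g"
    by (blast dest: homotopic_with_imp_continuous_maps)
  ultimately show "homotopy_class (subtopology Y W) G g = homotopy_class (subtopology Y W) G f"
    by (simp add: homotopy_class_eq_iff)
qed

locale group_like =
  fixes G :: "'b topology" and \<mu> :: "'b \<times> 'b \<Rightarrow> 'b" and e :: 'b and \<eta> :: "'b \<Rightarrow> 'b"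
  assumes group_like: "group_like_space G \<mu> e \<eta>"
begin

lemma unit_in_space [simp]: "e \<in> topspace G"
  and continuous_mult: "continuous_map (prod_topology G G) G \<mu>"
  and continuous_inverse: "continuous_map G G \<eta>"
  using group_like by (auto simp: group_like_space_def)

lemma continuous_map_mult:
  "continuous_map Y G f \<Longrightarrow> continuous_map Y G g \<Longrightarrow> continuous_map Y G (\<lambda>x. \<mu> (f x, g x))"
  using continuous_map_compose[OF continuous_map_pairedI continuous_mult, of Y f g]
  by (simp add: o_def)

lemma continuous_map_inverse: "continuous_map Y G f \<Longrightarrow> continuous_map Y G (\<lambda>x. \<eta> (f x))"
  using continuous_map_compose[OF _ continuous_inverse, of Y f] by (simp add: o_def)

lemma continuous_map_unit: "continuous_map Y G (\<lambda>_. e)"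
  by simp

lemma homotopic_maps_mult:
  assumes "homotopic_maps Y G f f'" and "homotopic_maps Y G g g'"
  shows "homotopic_maps Y G (\<lambda>x. \<mu> (f x, g x)) (\<lambda>x. \<mu> (f' x, g' x))"
  by (rule homotopic_maps_left[OF homotopic_maps_paired[OF assms] continuous_mult])

lemma mult_homotopy_class:
  assumes f: "continuous_map Y G f" and g: "continuous_map Y G g"
  shows "homotopy_class Y G f \<otimes>\<^bsub>homotopy_group Y G \<mu> e\<^esub> homotopy_class Y G g
           = homotopy_class Y G (\<lambda>x. \<mu> (f x, g x))"
proof -
  have "homotopy_class Y G (\<lambda>x. \<mu> (f' x, g' x)) = homotopy_class Y G (\<lambda>x. \<mu> (f x, g x))"
    if "homotopic_maps Y G f f'" "homotopic_maps Y G g g'" for f' g'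
    using homotopy_class_eq_iff[OF continuous_map_mult[OF f g]] homotopic_maps_mult[OF that]
    by blast
  then show ?thesis
    unfolding homotopy_group_def monoid.simps
    by (intro UN_homotopy_class_const f g)
qed

lemma one_homotopy_group: "\<one>\<^bsub>homotopy_group Y G \<mu> e\<^esub> = homotopy_class Y G (\<lambda>_. e)"
  by (simp add: homotopy_group_def)

lemma carrier_homotopy_group:
  "carrier (homotopy_group Y G \<mu> e) = homotopy_class Y G ` {f. continuous_map Y G f}"
  by (simp add: homotopy_group_def homotopy_classes_def)

text \<open>The group laws up to homotopy hold for the universal maps on powers of \<open>G\<close>; precomposition
  transports them to maps from an arbitrary space.\<close>

lemma
  assumes f: "continuous_map Y G f"
  shows mult_assoc: "continuous_map Y G g \<Longrightarrow> continuous_map Y G h \<Longrightarrow>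
      homotopic_maps Y G (\<lambda>x. \<mu> (\<mu> (f x, g x), h x)) (\<lambda>x. \<mu> (f x, \<mu> (g x, h x)))"
    and mult_unit_left: "homotopic_maps Y G (\<lambda>x. \<mu> (e, f x)) f"
    and mult_inverse_left: "homotopic_maps Y G (\<lambda>x. \<mu> (\<eta> (f x), f x)) (\<lambda>_. e)"
proof -
  assume g: "continuous_map Y G g" and h: "continuous_map Y G h"
  have "homotopic_maps (prod_topology (prod_topology G G) G) G
       (\<lambda>((x, y), z). \<mu> (\<mu> (x, y), z)) (\<lambda>((x, y), z). \<mu> (x, \<mu> (y, z)))"
    using group_like by (simp add: group_like_space_def)
  from homotopic_maps_right[OF this, of Y "\<lambda>x. ((f x, g x), h x)"]
  show "homotopic_maps Y G (\<lambda>x. \<mu> (\<mu> (f x, g x), h x)) (\<lambda>x. \<mu> (f x, \<mu> (g x, h x)))"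
    by (simp add: continuous_map_pairedI f g h)
next
  have "homotopic_maps G G (\<lambda>x. \<mu> (e, x)) (\<lambda>x. x)"
    using group_like by (simp add: group_like_space_def)
  from homotopic_maps_right[OF this f] show "homotopic_maps Y G (\<lambda>x. \<mu> (e, f x)) f" by simp
next
  have "homotopic_maps G G (\<lambda>x. \<mu> (\<eta> x, x)) (\<lambda>_. e)"
    using group_like by (simp add: group_like_space_def)
  from homotopic_maps_right[OF this f]
  show "homotopic_maps Y G (\<lambda>x. \<mu> (\<eta> (f x), f x)) (\<lambda>_. e)" by simp
qed

proposition group_homotopy_group: "group (homotopy_group Y G \<mu> e)"
proof (rule groupI)
  note simps = carrier_homotopy_group one_homotopy_group
  fix A assume "A \<in> carrier (homotopy_group Y G \<mu> e)"
  then obtain f where f: "continuous_map Y G f" and A: "A = homotopy_class Y G f"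
    by (auto simp: simps)
  show "\<one>\<^bsub>homotopy_group Y G \<mu> e\<^esub> \<otimes>\<^bsub>homotopy_group Y G \<mu> e\<^esub> A = A"
    unfolding A simps
    by (simp add: mult_homotopy_class continuous_map_unit f homotopy_class_eq_iff
        continuous_map_mult mult_unit_left)
  have "homotopy_class Y G (\<lambda>x. \<eta> (f x)) \<otimes>\<^bsub>homotopy_group Y G \<mu> e\<^esub> A = \<one>\<^bsub>homotopy_group Y G \<mu> e\<^esub>"
    unfolding A simps
    by (simp add: mult_homotopy_class continuous_map_inverse f homotopy_class_eq_iff
        continuous_map_mult mult_inverse_left)
  then show "\<exists>B\<in>carrier (homotopy_group Y G \<mu> e).
      B \<otimes>\<^bsub>homotopy_group Y G \<mu> e\<^esub> A = \<one>\<^bsub>homotopy_group Y G \<mu> e\<^esub>"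
    unfolding simps using continuous_map_inverse[OF f] by blast
  fix B assume "B \<in> carrier (homotopy_group Y G \<mu> e)"
  then obtain g where g: "continuous_map Y G g" and B: "B = homotopy_class Y G g"
    by (auto simp: simps)
  show "A \<otimes>\<^bsub>homotopy_group Y G \<mu> e\<^esub> B \<in> carrier (homotopy_group Y G \<mu> e)"
    unfolding A B by (auto simp: simps mult_homotopy_class f g continuous_map_mult)
  fix C assume "C \<in> carrier (homotopy_group Y G \<mu> e)"
  then obtain h where h: "continuous_map Y G h" and C: "C = homotopy_class Y G h"
    by (auto simp: simps)
  show "A \<otimes>\<^bsub>homotopy_group Y G \<mu> e\<^esub> B \<otimes>\<^bsub>homotopy_group Y G \<mu> e\<^esub> C
      = A \<otimes>\<^bsub>homotopy_group Y G \<mu> e\<^esub> (B \<otimes>\<^bsub>homotopy_group Y G \<mu> e\<^esub> C)"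
    unfolding A B C
    by (simp add: mult_homotopy_class f g h homotopy_class_eq_iff continuous_map_mult mult_assoc)
next
  show "\<one>\<^bsub>homotopy_group Y G \<mu> e\<^esub> \<in> carrier (homotopy_group Y G \<mu> e)"
    using continuous_map_unit by (auto simp: one_homotopy_group carrier_homotopy_group)
qed

lemma inv_homotopy_class:
  assumes f: "continuous_map Y G f"
  shows "inv\<^bsub>homotopy_group Y G \<mu> e\<^esub> (homotopy_class Y G f) = homotopy_class Y G (\<lambda>x. \<eta> (f x))"
proof (rule group.inv_equality[OF group_homotopy_group])
  show "homotopy_class Y G (\<lambda>x. \<eta> (f x)) \<otimes>\<^bsub>homotopy_group Y G \<mu> e\<^esub> homotopy_class Y G f
      = \<one>\<^bsub>homotopy_group Y G \<mu> e\<^esub>"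
    by (simp add: mult_homotopy_class one_homotopy_group continuous_map_inverse f
        homotopy_class_eq_iff continuous_map_mult mult_inverse_left)
qed (use f continuous_map_inverse[OF f] in \<open>auto simp: carrier_homotopy_group\<close>)

definition commutator_map :: "'b \<times> 'b \<Rightarrow> 'b" where
  "commutator_map = (\<lambda>(x, y). \<mu> (\<mu> (\<mu> (x, y), \<eta> x), \<eta> y))"

lemma continuous_commutator_map: "continuous_map (prod_topology G G) G commutator_map"
  unfolding commutator_map_def case_prod_unfold
  by (intro continuous_map_mult continuous_map_inverse continuous_map_fst continuous_map_snd)

lemma commutator_homotopy_class:
  assumes h: "continuous_map Y G h" and k: "continuous_map Y G k"
  shows "homotopy_class Y G h \<otimes>\<^bsub>homotopy_group Y G \<mu> e\<^esub> homotopy_class Y G k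
       \<otimes>\<^bsub>homotopy_group Y G \<mu> e\<^esub> inv\<^bsub>homotopy_group Y G \<mu> e\<^esub> homotopy_class Y G h
       \<otimes>\<^bsub>homotopy_group Y G \<mu> e\<^esub> inv\<^bsub>homotopy_group Y G \<mu> e\<^esub> homotopy_class Y G k
     = homotopy_class Y G (\<lambda>x. commutator_map (h x, k x))"
  by (simp add: commutator_map_def inv_homotopy_class mult_homotopy_class h k
      continuous_map_mult continuous_map_inverse)

text \<open>On either axis of \<open>G \<times> G\<close> the commutator map represents, in the group \<open>[G, G]\<close>, the commutator of
  the class of the identity with the neutral element. The resulting nullhomotopies are free: at the
  point \<open>(e, e)\<close> they may trace two different paths to \<open>e\<close>.\<close>

lemma
  shows commutator_map_unit_left: "homotopic_maps G G (\<lambda>y. commutator_map (e, y)) (\<lambda>_. e)"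
    and commutator_map_unit_right: "homotopic_maps G G (\<lambda>x. commutator_map (x, e)) (\<lambda>_. e)"
proof -
  interpret HG: group "homotopy_group G G \<mu> e" by (rule group_homotopy_group)
  have id: "continuous_map G G (\<lambda>x. x)" by simp
  have mem: "homotopy_class G G (\<lambda>x. x) \<in> carrier (homotopy_group G G \<mu> e)"
    by (auto simp: carrier_homotopy_group)
  have cont: "continuous_map G G (\<lambda>y. commutator_map (e, y))"
      "continuous_map G G (\<lambda>x. commutator_map (x, e))"
    using continuous_map_compose[OF continuous_map_pairedI[OF continuous_map_unit id]
        continuous_commutator_map]
      continuous_map_compose[OF continuous_map_pairedI[OF id continuous_map_unit]
        continuous_commutator_map]
    by (simp_all add: o_def)
  have "homotopy_class G G (\<lambda>y. commutator_map (e, y)) = homotopy_class G G (\<lambda>_. e)"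
    using commutator_homotopy_class[OF continuous_map_unit id] mem
    by (simp flip: one_homotopy_group)
  then show "homotopic_maps G G (\<lambda>y. commutator_map (e, y)) (\<lambda>_. e)"
    using homotopy_class_eq_iff[OF cont(1)] by blast
  have "homotopy_class G G (\<lambda>x. commutator_map (x, e)) = homotopy_class G G (\<lambda>_. e)"
    using commutator_homotopy_class[OF id continuous_map_unit] mem
    by (simp flip: one_homotopy_group)
  then show "homotopic_maps G G (\<lambda>x. commutator_map (x, e)) (\<lambda>_. e)"
    using homotopy_class_eq_iff[OF cont(2)] by blast
qed

lemma group_hom_restrict_class:
  "group_hom (homotopy_group Y G \<mu> e) (homotopy_group (subtopology Y W) G \<mu> e) (restrict_class Y G W)"
proof (intro group_hom.intro group_hom_axioms.intro group_homotopy_group homI)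
  fix A B assume "A \<in> carrier (homotopy_group Y G \<mu> e)" "B \<in> carrier (homotopy_group Y G \<mu> e)"
  then obtain f g where f: "continuous_map Y G f" "A = homotopy_class Y G f"
    and g: "continuous_map Y G g" "B = homotopy_class Y G g"
    by (auto simp: carrier_homotopy_group)
  show "restrict_class Y G W A \<in> carrier (homotopy_group (subtopology Y W) G \<mu> e)"
    using f by (auto simp: carrier_homotopy_group restrict_class_homotopy_class
        intro: continuous_map_from_subtopology)
  show "restrict_class Y G W (A \<otimes>\<^bsub>homotopy_group Y G \<mu> e\<^esub> B)
      = restrict_class Y G W A \<otimes>\<^bsub>homotopy_group (subtopology Y W) G \<mu> e\<^esub> restrict_class Y G W B"
    using f g by (simp add: restrict_class_homotopy_class mult_homotopy_class continuous_map_mult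
        continuous_map_from_subtopology)
qed

text \<open>The normal subgroup written \<open>N(W)\<close> in the introduction.\<close>

definition null_classes :: "'a topology \<Rightarrow> 'a set \<Rightarrow> ('a \<Rightarrow> 'b) set set" where
  "null_classes Y W = homotopy_class Y G `
     {f. continuous_map Y G f \<and> homotopic_maps (subtopology Y W) G f (\<lambda>_. e)}"

lemma null_classes_normal: "null_classes Y W \<lhd> homotopy_group Y G \<mu> e"
proof -
  have "null_classes Y W = kernel (homotopy_group Y G \<mu> e)
      (homotopy_group (subtopology Y W) G \<mu> e) (restrict_class Y G W)"
  proof -
    have "restrict_class Y G W (homotopy_class Y G f) = homotopy_class (subtopology Y W) G (\<lambda>_. e)
        \<longleftrightarrow> homotopic_maps (subtopology Y W) G f (\<lambda>_. e)" if "continuous_map Y G f" for f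
      using that by (simp add: restrict_class_homotopy_class homotopy_class_eq_iff
          continuous_map_from_subtopology)
    then show ?thesis
      unfolding null_classes_def kernel_def carrier_homotopy_group one_homotopy_group by blast
  qed
  then show ?thesis
    using group_hom.normal_kernel[OF group_hom_restrict_class] by simp
qed

lemma homotopy_class_in_null_classes_iff:
  assumes f: "continuous_map Y G f"
  shows "homotopy_class Y G f \<in> null_classes Y W \<longleftrightarrow>
    homotopic_maps (subtopology Y W) G f (\<lambda>_. e)"
proof
  assume "homotopy_class Y G f \<in> null_classes Y W"
  then obtain g where g: "homotopic_maps Y G f g" "homotopic_maps (subtopology Y W) G g (\<lambda>_. e)"
    by (auto simp: null_classes_def homotopy_class_eq_iff f)
  then show "homotopic_maps (subtopology Y W) G f (\<lambda>_. e)"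
    by (blast intro: homotopic_with_trans homotopic_from_subtopology)
qed (use f in \<open>auto simp: null_classes_def\<close>)

end

section \<open>Nullhomotopies on a union of two open sets\<close>

text \<open>A homotopy \<open>F\<close> of \<open>f\<close> that is only given on the sublevel set \<open>l \<le> b\<close> extends to the whole space
  after slowing it down by a factor \<open>\<rho>\<close> which vanishes on the level set \<open>l = b\<close>. This replaces the
  homotopy extension property.\<close>

lemma homotopic_maps_deform_sublevel:
  fixes l \<rho> :: "'a \<Rightarrow> real"
  assumes f: "continuous_map W G f"
    and l: "continuous_map W euclideanreal l"
    and \<rho>: "continuous_map W euclideanreal \<rho>" "\<And>x. 0 \<le> \<rho> x" "\<And>x. \<rho> x \<le> 1"
    and F: "continuous_map (prod_topology (top_of_set {0..1}) (subtopology W {x. l x \<le> b})) G F"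
    and F0: "\<And>x. l x \<le> b \<Longrightarrow> F (0, x) = f x"
    and \<rho>0: "\<And>x. l x = b \<Longrightarrow> \<rho> x = 0"
  shows "homotopic_maps W G f (\<lambda>x. if l x \<le> b then F (\<rho> x, x) else f x)"
proof -
  let ?P = "prod_topology (top_of_set {0..1::real}) W"
  let ?S = "{p \<in> topspace ?P. l (snd p) \<le> b}"
  let ?K = "\<lambda>p. if l (snd p) \<le> b then F (fst p * \<rho> (snd p), snd p) else f (snd p)"
  have fst: "continuous_map ?P euclideanreal fst"
    using continuous_map_fst continuous_map_in_subtopology by blast
  have snd: "continuous_map ?P euclideanreal (\<lambda>p. r (snd p))" if "continuous_map W euclideanreal r" for r
    using continuous_map_compose[OF continuous_map_snd that] by (simp add: o_def)
  have "continuous_map (subtopology ?P ?S) G (\<lambda>p. F (fst p * \<rho> (snd p), snd p))"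
  proof -
    have 1: "continuous_map (subtopology ?P ?S) (top_of_set {0..1}) (\<lambda>p. fst p * \<rho> (snd p))"
    proof (rule continuous_map_into_subtopology)
      show "continuous_map (subtopology ?P ?S) euclideanreal (\<lambda>p. fst p * \<rho> (snd p))"
        by (intro continuous_map_from_subtopology continuous_map_real_mult fst snd \<rho>)
      show "(\<lambda>p. fst p * \<rho> (snd p)) \<in> topspace (subtopology ?P ?S) \<rightarrow> {0..1}"
        by (auto simp: \<rho>(2,3) mult_le_one)
    qed
    have 2: "continuous_map (subtopology ?P ?S) (subtopology W {x. l x \<le> b}) snd"
      by (intro continuous_map_into_subtopology continuous_map_from_subtopology continuous_map_snd) auto
    show ?thesis
      using continuous_map_compose[OF continuous_map_pairedI[OF 1 2] F] by (simp add: o_def)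
  qed
  moreover have "continuous_map ?P G (\<lambda>p. f (snd p))"
    using continuous_map_compose[OF continuous_map_snd f] by (simp add: o_def)
  ultimately have "continuous_map ?P G ?K"
    by (intro continuous_map_cases_le snd l) (auto simp: F0 \<rho>0 intro: continuous_map_from_subtopology)
  then show ?thesis
    unfolding homotopic_with_def by (intro exI[of _ ?K]) (auto simp: F0)
qed

definition clamp01 :: "real \<Rightarrow> real" where "clamp01 s = max 0 (min 1 s)"

lemma continuous_map_clamp01_affine:
  assumes "continuous_map W euclideanreal l"
  shows "continuous_map W euclideanreal (\<lambda>x. clamp01 (a * l x + b))"
proof -
  have "continuous_map W euclideanreal (\<lambda>x. a * l x + b)"
    by (rule continuous_map_add[OF continuous_map_real_mult_left[OF assms]]) simp
  then show ?thesis
    unfolding clamp01_def by (intro continuous_map_real_max continuous_map_real_min) auto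
qed

lemma clamp01_bounds [simp]: "0 \<le> clamp01 s" "clamp01 s \<le> 1"
  and clamp01_le_0: "s \<le> 0 \<Longrightarrow> clamp01 s = 0"
  and clamp01_ge_1: "1 \<le> s \<Longrightarrow> clamp01 s = 1"
  by (auto simp: clamp01_def)

text \<open>A map that is nullhomotopic on an open set may be assumed constant on a smaller closed set. The
  bound \<open>2/3\<close> is taken above \<open>1/2\<close> so that, after applying this to \<open>l\<close> and to \<open>1 - l\<close>, the regions of
  constancy overlap in the band \<open>1/3 \<le> l \<le> 2/3\<close>.\<close>

lemma make_constant_on_sublevel:
  fixes l :: "'a \<Rightarrow> real"
  assumes h: "continuous_map W G h" and l: "continuous_map W euclideanreal l"
    and null: "homotopic_maps (subtopology W U) G h (\<lambda>_. e)"
    and sub: "\<And>x. x \<in> topspace W \<Longrightarrow> l x < 1 \<Longrightarrow> x \<in> U"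
  obtains h' where "homotopic_maps W G h h'" "\<And>x. l x \<le> 2/3 \<Longrightarrow> h' x = e"
proof -
  obtain F where F: "continuous_map (prod_topology (top_of_set {0..1::real}) (subtopology W U)) G F"
      "\<And>x. F (0, x) = h x" "\<And>x. F (1, x) = e"
    using null by (auto simp: homotopic_with_def)
  have "topspace W \<inter> {x. l x \<le> 5/6} = topspace W \<inter> (U \<inter> {x. l x \<le> 5/6})"
    using sub by force
  then have "subtopology W (topspace W \<inter> {x. l x \<le> 5/6})
      = subtopology W (topspace W \<inter> (U \<inter> {x. l x \<le> 5/6}))"
    by (rule arg_cong)
  then have eq: "subtopology W {x. l x \<le> 5/6} = subtopology (subtopology W U) {x. l x \<le> 5/6}"
    by (simp only: subtopology_restrict subtopology_subtopology)
  \<comment> \<open>The level \<open>5/6\<close> leaves room between \<open>2/3\<close>, where \<open>F\<close> must have run completely, and \<open>1\<close>, beyond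
    which \<open>F\<close> has no meaning; \<open>5 - 6 l\<close> falls from \<open>1\<close> to \<open>0\<close> between \<open>2/3\<close> and \<open>5/6\<close>.\<close>
  have K: "continuous_map (prod_topology (top_of_set {0..1::real}) (subtopology W {x. l x \<le> 5/6})) G F"
    unfolding eq prod_topology_subtopology(2)[of _ "subtopology W U"]
    by (rule continuous_map_from_subtopology[OF F(1)])
  have "homotopic_maps W G h (\<lambda>x. if l x \<le> 5/6 then F (clamp01 (-6 * l x + 5), x) else h x)"
    by (rule homotopic_maps_deform_sublevel[OF h l continuous_map_clamp01_affine[OF l, of "-6" 5] _ _ K])
      (simp_all add: F(2) clamp01_le_0)
  then show ?thesis
    by (rule that) (auto simp: clamp01_ge_1 F(3))
qed

text \<open>After \<open>h\<close> and \<open>k\<close> have been made constant on overlapping sets, \<open>C(h, k)\<close> equals \<open>C(e, k)\<close> where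
  \<open>l \<le> 2/3\<close> and \<open>C(h, e)\<close> where \<open>l \<ge> 1/3\<close>. The given nullhomotopies \<open>P\<close> of \<open>C(e, -)\<close> and \<open>Q\<close> of \<open>C(-, e)\<close> are
  run on \<open>l \<le> 1/2\<close> and \<open>l \<ge> 1/2\<close> respectively, completely outside the band \<open>1/3 < l < 2/3\<close> and less and
  less towards its middle. Outside the band the result is \<open>e\<close>; inside it both \<open>h\<close> and \<open>k\<close> are \<open>e\<close>, so the
  result depends on \<open>l\<close> alone. Altogether it is a path in \<open>G\<close> composed with \<open>l\<close>.\<close>

proposition nullhomotopic_on_union:
  fixes W :: "'a topology"
  assumes W: "normal_space W" and U: "openin W U" and V: "openin W V" and UV: "U \<union> V = topspace W"
    and G: "path_connected_space G" and e: "e \<in> topspace G"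
    and C: "continuous_map (prod_topology G G) G C"
    and C1: "homotopic_maps G G (\<lambda>y. C (e, y)) (\<lambda>_. e)"
    and C2: "homotopic_maps G G (\<lambda>x. C (x, e)) (\<lambda>_. e)"
    and h: "continuous_map W G h" "homotopic_maps (subtopology W U) G h (\<lambda>_. e)"
    and k: "continuous_map W G k" "homotopic_maps (subtopology W V) G k (\<lambda>_. e)"
  shows "homotopic_maps W G (\<lambda>x. C (h x, k x)) (\<lambda>_. e)"
proof -
  have "closedin W (topspace W - V)" "closedin W (topspace W - U)"
      "disjnt (topspace W - V) (topspace W - U)"
    using U V UV by (auto simp: disjnt_def)
  then obtain l :: "'a \<Rightarrow> real" where l: "continuous_map W euclideanreal l"
    and l01: "l ` (topspace W - V) \<subseteq> {0}" "l ` (topspace W - U) \<subseteq> {1}"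
    by (rule Urysohn_lemma_alt[OF W])
  have l0: "x \<in> V" if "x \<in> topspace W" "0 < l x" for x
    using l01(1) that by (metis DiffI image_subset_iff less_irrefl singletonD)
  have l1: "x \<in> U" if "x \<in> topspace W" "l x < 1" for x
    using l01(2) that by (metis DiffI image_subset_iff less_irrefl singletonD)
  have l': "continuous_map W euclideanreal (\<lambda>x. 1 - l x)"
    by (intro continuous_map_diff l) auto
  obtain h' where h': "homotopic_maps W G h h'" "\<And>x. l x \<le> 2/3 \<Longrightarrow> h' x = e"
    using make_constant_on_sublevel[OF h(1) l h(2) l1] by blast
  obtain k' where k': "homotopic_maps W G k k'" "\<And>x. 1/3 \<le> l x \<Longrightarrow> k' x = e"
    by (rule make_constant_on_sublevel[OF k(1) l' k(2)]) (use l0 in auto)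
  have cont: "continuous_map W G h'" "continuous_map W G k'"
    using h'(1) k'(1) by (auto dest: homotopic_with_imp_continuous_maps)
  obtain P where P: "continuous_map (prod_topology (top_of_set {0..1::real}) G) G P"
      "\<And>y. P (0, y) = C (e, y)" "\<And>y. P (1, y) = e"
    using C1 by (auto simp: homotopic_with_def)
  obtain Q where Q: "continuous_map (prod_topology (top_of_set {0..1::real}) G) G Q"
      "\<And>x. Q (0, x) = C (x, e)" "\<And>x. Q (1, x) = e"
    using C2 by (auto simp: homotopic_with_def)
  have track: "continuous_map (prod_topology (top_of_set {0..1::real}) (subtopology W S)) G (\<lambda>p. H (fst p, g (snd p)))"
    if H: "continuous_map (prod_topology (top_of_set {0..1::real}) G) G H" and g: "continuous_map W G g"
    for H g S
  proof -
    have "continuous_map (prod_topology (top_of_set {0..1::real}) (subtopology W S)) G (\<lambda>p. g (snd p))"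
      using continuous_map_compose[OF continuous_map_snd continuous_map_from_subtopology[OF g]]
      by (simp add: o_def)
    from continuous_map_compose[OF continuous_map_pairedI[OF continuous_map_fst this] H]
    show ?thesis by (simp add: o_def)
  qed
  \<comment> \<open>\<open>3 - 6 l\<close> falls from \<open>1\<close> at \<open>l = 1/3\<close> to \<open>0\<close> at \<open>l = 1/2\<close>, and \<open>6 l - 3\<close> rises symmetrically. The path
    \<open>w\<close> runs from \<open>e\<close> along \<open>P(-, e)\<close> backwards to \<open>C(e, e)\<close> and returns to \<open>e\<close> along \<open>Q(-, e)\<close>.\<close>
  define f0 where "f0 = (\<lambda>x. C (h' x, k' x))"
  define f1 where "f1 = (\<lambda>x. if l x \<le> 1/2 then P (clamp01 (-6 * l x + 3), k' x) else f0 x)"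
  define f2 where "f2 = (\<lambda>x. if 1 - l x \<le> 1/2 then Q (clamp01 (6 * l x + -3), h' x) else f1 x)"
  define w where "w = (\<lambda>s. if s \<le> 1/2 then P (clamp01 (-6 * s + 3), e) else Q (clamp01 (6 * s + -3), e))"
  have f: "homotopic_maps W G (\<lambda>x. C (h x, k x)) f0"
    unfolding f0_def by (rule homotopic_maps_left[OF homotopic_maps_paired[OF h'(1) k'(1)] C])
  then have f0: "continuous_map W G f0"
    by (blast dest: homotopic_with_imp_continuous_maps)
  have f01: "homotopic_maps W G f0 f1"
    unfolding f1_def
    by (rule homotopic_maps_deform_sublevel[OF f0 l continuous_map_clamp01_affine[OF l, of "-6" 3] _ _ track[OF P(1) cont(2)],
          unfolded fst_conv snd_conv])
      (simp_all add: P(2) f0_def h'(2) clamp01_le_0)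
  then have f1: "continuous_map W G f1"
    by (blast dest: homotopic_with_imp_continuous_maps)
  have f12: "homotopic_maps W G f1 f2"
    unfolding f2_def
    by (rule homotopic_maps_deform_sublevel[OF f1 l' continuous_map_clamp01_affine[OF l, of 6 "-3"] _ _ track[OF Q(1) cont(1)],
          unfolded fst_conv snd_conv])
      (auto simp: P(2) Q(2) f0_def f1_def h'(2) k'(2) clamp01_le_0)
  have f2: "f2 x = w (l x)" for x
    by (cases "l x \<le> 1/3"; cases "2/3 \<le> l x"; cases "l x = 1/2")
      (auto simp: f2_def f1_def w_def h'(2) k'(2) P Q clamp01_le_0 clamp01_ge_1)
  have w: "continuous_map euclideanreal G w"
  proof -
    have H: "continuous_map euclideanreal G (\<lambda>s. H (clamp01 (a * s + b), e))"
      if H: "continuous_map (prod_topology (top_of_set {0..1::real}) G) G H" for H a b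
    proof -
      have "continuous_map euclideanreal (top_of_set {0..1}) (\<lambda>s. clamp01 (a * s + b))"
        using continuous_map_clamp01_affine[of euclideanreal "\<lambda>s. s" a b] by (intro continuous_map_into_subtopology) auto
      moreover have "continuous_map euclideanreal G (\<lambda>_. e)" using e by simp
      ultimately show ?thesis
        using continuous_map_compose[OF continuous_map_pairedI H, of euclideanreal] by (simp add: o_def)
    qed
    show ?thesis
      unfolding w_def
      by (intro continuous_map_cases_le continuous_map_from_subtopology)
        (use H[OF P(1), of "-6" 3] H[OF Q(1), of 6 "-3"] in \<open>auto simp: P(2) Q(2) clamp01_le_0\<close>)
  qed
  obtain d where "homotopic_maps W G (w \<circ> l) (\<lambda>_. d)"
    by (rule nullhomotopic_through_contractible_space[OF l w contractible_space_euclideanreal])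
  then have f2d: "homotopic_maps W G f2 (\<lambda>_. d)"
    by (rule homotopic_with_eq) (simp_all add: f2)
  have "homotopic_maps W G (\<lambda>_. d) (\<lambda>_. e)"
  proof (cases "W = trivial_topology")
    case True
    then show ?thesis by (simp add: homotopic_on_emptyI)
  next
    case False
    with f2d have "d \<in> topspace G"
      by (auto dest: homotopic_with_imp_continuous_maps)
    then show ?thesis by (rule homotopic_maps_constant[OF G _ e])
  qed
  then show ?thesis
    by (intro homotopic_with_trans[OF f] homotopic_with_trans[OF f01] homotopic_with_trans[OF f12]
        homotopic_with_trans[OF f2d])
qed

section \<open>Motion planners and the diagonal\<close>

lemma mem_topspace_path_space:
  "\<gamma> \<in> topspace (path_space X) \<Longrightarrow> continuous_map (top_of_set {0..1}) X \<gamma>"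
  by (auto simp: path_space_def compact_open_topology_def)

text \<open>Evaluation is continuous for the compact-open topology because the unit interval is locally
  compact: a path that is in \<open>V\<close> at time \<open>\<tau>\<close> stays in \<open>V\<close> on a compact neighbourhood \<open>K\<close> of \<open>\<tau>\<close>, and mapping
  \<open>K\<close> into \<open>V\<close> is an open condition.\<close>

lemma continuous_map_path_eval:
  "continuous_map (prod_topology (path_space X) (top_of_set {0..1})) X (\<lambda>p. fst p (snd p))"
  unfolding continuous_map
proof (intro conjI allI impI)
  let ?P = "prod_topology (path_space X) (top_of_set {0..1::real})"
  have "\<gamma> \<tau> \<in> topspace X" if "\<gamma> \<in> topspace (path_space X)" "\<tau> \<in> {0..1}" for \<gamma> \<tau>
    using mem_topspace_path_space[OF that(1)] that(2) by (auto simp: continuous_map_def Pi_iff)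
  then show "(\<lambda>p. fst p (snd p)) ` topspace ?P \<subseteq> topspace X"
    by auto
  fix V assume V: "openin X V"
  show "openin ?P {p \<in> topspace ?P. fst p (snd p) \<in> V}"
  proof (subst openin_subopen, intro ballI)
    fix p assume p: "p \<in> {p \<in> topspace ?P. fst p (snd p) \<in> V}"
    obtain \<gamma> \<tau> where p_eq: "p = (\<gamma>, \<tau>)" by (cases p)
    have \<gamma>: "\<gamma> \<in> topspace (path_space X)" and \<tau>: "\<tau> \<in> {0..1}" "\<gamma> \<tau> \<in> V"
      using p by (auto simp: p_eq)
    have cont: "continuous_map (top_of_set {0..1}) X \<gamma>" by (rule mem_topspace_path_space[OF \<gamma>])
    have "openin (top_of_set {0..1}) {s \<in> {0..1}. \<gamma> s \<in> V}"
      using openin_continuous_map_preimage[OF cont V] by simp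
    then obtain \<epsilon> where \<epsilon>: "\<epsilon> > 0" "cball \<tau> \<epsilon> \<inter> {0..1} \<subseteq> {s \<in> {0..1}. \<gamma> s \<in> V}"
      using \<tau> unfolding openin_contains_cball by blast
    define K where "K = cball \<tau> \<epsilon> \<inter> {0..1}"
    define N where "N = {f \<in> extensional {0..1}. continuous_map (top_of_set {0..1}) X f \<and> f ` K \<subseteq> V}"
    have "compactin (top_of_set {0..1}) K"
      by (auto simp: K_def compactin_subtopology compact_Int)
    then have N: "openin (path_space X) N"
      unfolding path_space_def compact_open_topology_def N_def
      by (intro topology_generated_by_Basis) (use V in auto)
    have "\<gamma> \<in> N"
      using \<epsilon>(2) \<gamma> cont by (auto simp: N_def K_def path_space_def compact_open_topology_def)
    moreover have "openin (top_of_set {0..1}) (ball \<tau> \<epsilon> \<inter> {0..1})"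
      by (subst Int_commute) (rule openin_open_Int[OF open_ball])
    moreover have "N \<times> (ball \<tau> \<epsilon> \<inter> {0..1}) \<subseteq> {p \<in> topspace ?P. fst p (snd p) \<in> V}"
      using openin_subset[OF N] by (auto simp: N_def K_def image_subset_iff)
    ultimately show "\<exists>T. openin ?P T \<and> p \<in> T \<and> T \<subseteq> {p \<in> topspace ?P. fst p (snd p) \<in> V}"
      using N \<epsilon>(1) \<tau>(1)
      by (intro exI[of _ "N \<times> (ball \<tau> \<epsilon> \<inter> {0..1})"]) (simp add: p_eq openin_prod_Times_iff)
  qed
qed

text \<open>The deformation is \<open>(\<tau>, x) \<mapsto> (s(x)(\<tau> t\<^sub>1), \<dots>, s(x)(\<tau> t\<^sub>m))\<close>. At \<open>\<tau> = 1\<close> it is the identity since \<open>s\<close> is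
  a section; at \<open>\<tau> = 0\<close> all coordinates are the starting point of the path \<open>s(x)\<close>.\<close>

lemma motion_section_deforms_into_diagonal:
  assumes U: "U \<subseteq> topspace (cartesian_power m X)"
    and sec: "has_motion_section m t X U"
    and t: "\<And>i. i \<in> {1..m} \<Longrightarrow> t i \<in> {0..1}"
  obtains d where
    "continuous_map (subtopology (cartesian_power m X) U)
       (subtopology (cartesian_power m X) (diagonal m X)) d"
    "homotopic_maps (subtopology (cartesian_power m X) U) (cartesian_power m X) d (\<lambda>x. x)"
proof -
  let ?Y = "cartesian_power m X" and ?I = "top_of_set {0..1::real}"
  obtain s where s: "continuous_map (subtopology ?Y U) (path_space X) s"
    and eval: "\<And>x. x \<in> U \<Longrightarrow> path_evaluation m t (s x) = x"
    using sec by (auto simp: has_motion_section_def)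
  define K where "K = (\<lambda>p. \<lambda>i\<in>{1..m}. s (snd p) (fst p * t i))"
  let ?P = "prod_topology ?I (subtopology ?Y U)"
  have coord: "continuous_map ?P X (\<lambda>p. s (snd p) (fst p * t i))" if i: "i \<in> {1..m}" for i
  proof -
    have 1: "continuous_map ?P ?I (\<lambda>p. fst p * t i)"
    proof (rule continuous_map_into_subtopology)
      have "continuous_map ?P euclideanreal fst"
        using continuous_map_fst continuous_map_in_subtopology by blast
      then show "continuous_map ?P euclideanreal (\<lambda>p. fst p * t i)"
        by (rule continuous_map_real_mult_right)
      show "(\<lambda>p. fst p * t i) \<in> topspace ?P \<rightarrow> {0..1}"
        using t[OF i] by (auto intro: mult_le_one)
    qed
    have 2: "continuous_map ?P (path_space X) (\<lambda>p. s (snd p))"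
      using continuous_map_compose[OF continuous_map_snd s] by (simp add: o_def)
    show ?thesis
      using continuous_map_compose[OF continuous_map_pairedI[OF 2 1] continuous_map_path_eval]
      by (simp add: o_def)
  qed
  have K: "continuous_map ?P ?Y K"
    unfolding continuous_map_componentwise using coord by (auto simp: K_def)
  have hom: "homotopic_maps (subtopology ?Y U) ?Y (\<lambda>x. K (0, x)) (\<lambda>x. x)"
  proof (subst homotopic_with)
    show "\<exists>h. continuous_map ?P ?Y h \<and> (\<forall>x\<in>topspace (subtopology ?Y U). h (0, x) = K (0, x)) \<and>
        (\<forall>x\<in>topspace (subtopology ?Y U). h (1, x) = x) \<and> (\<forall>t\<in>{0..1::real}. True)"
      using K eval by (intro exI[of _ K]) (auto simp: K_def path_evaluation_def)
  qed simp
  have "continuous_map (subtopology ?Y U) (subtopology ?Y (diagonal m X)) (\<lambda>x. K (0, x))"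
  proof (rule continuous_map_into_subtopology)
    show "continuous_map (subtopology ?Y U) ?Y (\<lambda>x. K (0, x))"
      using homotopic_with_imp_continuous_maps[OF hom] by simp
    have "s x 0 \<in> topspace X" if "x \<in> topspace (subtopology ?Y U)" for x
    proof -
      have "s x \<in> topspace (path_space X)" using s that by (auto simp: continuous_map_def)
      then show ?thesis
        using mem_topspace_path_space[of "s x" X] by (auto simp: continuous_map_def Pi_iff)
    qed
    then show "(\<lambda>x. K (0, x)) \<in> topspace (subtopology ?Y U) \<rightarrow> diagonal m X"
      by (auto simp: K_def diagonal_def)
  qed
  then show ?thesis using hom that by blast
qed

lemma nullhomotopic_on_motion_domain:
  assumes U: "U \<subseteq> topspace (cartesian_power m X)" "has_motion_section m t X U"
    and t: "\<And>i. i \<in> {1..m} \<Longrightarrow> t i \<in> {0..1}"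
    and f: "continuous_map (cartesian_power m X) G f"
    and null: "homotopic_maps (subtopology (cartesian_power m X) (diagonal m X)) G f (\<lambda>_. c)"
  shows "homotopic_maps (subtopology (cartesian_power m X) U) G f (\<lambda>_. c)"
proof -
  obtain d where d: "continuous_map (subtopology (cartesian_power m X) U)
       (subtopology (cartesian_power m X) (diagonal m X)) d"
    "homotopic_maps (subtopology (cartesian_power m X) U) (cartesian_power m X) d (\<lambda>x. x)"
    by (rule motion_section_deforms_into_diagonal[OF U t])
  have "homotopic_maps (subtopology (cartesian_power m X) U) G f (\<lambda>x. f (d x))"
    by (rule homotopic_with_symD[OF homotopic_maps_left[OF d(2) f]])
  then show ?thesis
    by (rule homotopic_with_trans[OF _ homotopic_maps_right[OF null d(1)]])
qed

section \<open>The central series of an open cover\<close>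

context group_like
begin

lemma null_classes_mono:
  "W \<subseteq> W' \<Longrightarrow> null_classes Y W' \<subseteq> null_classes Y W"
proof -
  assume "W \<subseteq> W'"
  then have "homotopic_maps (subtopology Y W) G f (\<lambda>_. e)"
    if "homotopic_maps (subtopology Y W') G f (\<lambda>_. e)" for f
    using homotopic_from_subtopology[OF that, of W] by (simp add: subtopology_subtopology Int_absorb1)
  then show ?thesis
    unfolding null_classes_def by blast
qed

lemma null_classes_topspace: "null_classes Y (topspace Y) = {\<one>\<^bsub>homotopy_group Y G \<mu> e\<^esub>}"
proof -
  have "null_classes Y (topspace Y)
      = homotopy_class Y G ` {f. continuous_map Y G f \<and> homotopy_class Y G f = homotopy_class Y G (\<lambda>_. e)}"
    unfolding null_classes_def subtopology_topspace
    by (intro arg_cong[of _ _ "image (homotopy_class Y G)"] Collect_cong conj_cong refl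
        homotopy_class_eq_iff[symmetric])
  also have "\<dots> = {homotopy_class Y G (\<lambda>_. e)}"
    using continuous_map_unit[of Y] by blast
  finally show ?thesis by (simp add: one_homotopy_group)
qed

text \<open>The union \<open>U \<union> V\<close> has to be normal for the Urysohn function to exist on it, and normality in general
  does not pass to open subspaces. Metrizability of \<open>Y\<close> provides it for all of them at once.\<close>

lemma commutator_in_null_classes_union:
  assumes Y: "metrizable_space Y" and G: "path_connected_space G"
    and U: "openin Y U" and V: "openin Y V"
    and A: "A \<in> null_classes Y U" and B: "B \<in> null_classes Y V"
  shows "A \<otimes>\<^bsub>homotopy_group Y G \<mu> e\<^esub> B
       \<otimes>\<^bsub>homotopy_group Y G \<mu> e\<^esub> inv\<^bsub>homotopy_group Y G \<mu> e\<^esub> A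
       \<otimes>\<^bsub>homotopy_group Y G \<mu> e\<^esub> inv\<^bsub>homotopy_group Y G \<mu> e\<^esub> B \<in> null_classes Y (U \<union> V)"
proof -
  obtain h k where h: "continuous_map Y G h" "homotopic_maps (subtopology Y U) G h (\<lambda>_. e)"
    and k: "continuous_map Y G k" "homotopic_maps (subtopology Y V) G k (\<lambda>_. e)"
    and AB: "A = homotopy_class Y G h" "B = homotopy_class Y G k"
    using A B by (auto simp: null_classes_def)
  let ?W = "subtopology Y (U \<union> V)"
  have sub: "subtopology ?W U = subtopology Y U" "subtopology ?W V = subtopology Y V"
    by (simp_all add: subtopology_subtopology Int_absorb1)
  have "homotopic_maps ?W G (\<lambda>x. commutator_map (h x, k x)) (\<lambda>_. e)"
  proof (rule nullhomotopic_on_union)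
    show "normal_space ?W"
      by (intro metrizable_imp_normal_space metrizable_space_subtopology Y)
    show "openin ?W U" "openin ?W V"
      using U V by (auto simp: openin_subtopology)
    show "U \<union> V = topspace ?W"
      using openin_subset[OF U] openin_subset[OF V] by auto
    show "homotopic_maps (subtopology ?W U) G h (\<lambda>_. e)" "homotopic_maps (subtopology ?W V) G k (\<lambda>_. e)"
      by (simp_all add: sub h k)
  qed (use G h k in \<open>auto intro: continuous_commutator_map commutator_map_unit_left
          commutator_map_unit_right continuous_map_from_subtopology\<close>)
  moreover have "continuous_map Y G (\<lambda>x. commutator_map (h x, k x))"
    using continuous_map_compose[OF continuous_map_pairedI[OF h(1) k(1)] continuous_commutator_map]
    by (simp add: o_def)
  ultimately show ?thesis
    unfolding AB commutator_homotopy_class[OF h(1) k(1)]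
    by (simp add: homotopy_class_in_null_classes_iff)
qed

text \<open>Since \<open>U\<^sub>0\<close> is already used up by the first term, which must be all of \<open>N(D)\<close>, a cover by \<open>n + 1\<close>
  sets leads to a series with only \<open>n\<close> steps.\<close>

proposition central_series_of_open_cover:
  fixes U :: "nat \<Rightarrow> 'a set"
  assumes Y: "metrizable_space Y" and G: "path_connected_space G"
    and U: "\<And>i. i \<le> n \<Longrightarrow> openin Y (U i)" and cover: "(\<Union>i\<le>n. U i) = topspace Y"
    and null: "\<And>i. i \<le> n \<Longrightarrow> null_classes Y D \<subseteq> null_classes Y (U i)"
  shows "is_central_series ((homotopy_group Y G \<mu> e)\<lparr>carrier := null_classes Y D\<rparr>) n
           (\<lambda>i. null_classes Y D \<inter> null_classes Y (\<Union>j<i. U j))"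
proof -
  let ?H = "homotopy_group Y G \<mu> e" and ?W = "\<lambda>i. \<Union>j<i. U j"
  let ?\<Gamma> = "\<lambda>i. null_classes Y D \<inter> null_classes Y (?W i)"
  interpret H: group ?H by (rule group_homotopy_group)
  have sub: "subgroup (null_classes Y S) ?H" for S
    by (rule normal_imp_subgroup[OF null_classes_normal])
  have one: "\<one>\<^bsub>?H\<^esub> \<in> null_classes Y S" for S
    by (rule subgroup.one_closed[OF sub])
  have W_Suc: "?W (i + 1) = U i \<union> ?W i" for i
    by (auto simp: less_Suc_eq)
  have "?\<Gamma> 1 = null_classes Y D"
    using null[of 0] by (auto simp: lessThan_Suc)
  moreover have "?W (n + 1) = topspace Y"
    using cover by (simp add: lessThan_Suc_atMost)
  then have "?\<Gamma> (n + 1) = {\<one>\<^bsub>?H\<^esub>}"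
    using one[of D] by (simp only: null_classes_topspace) auto
  moreover have "?\<Gamma> (i + 1) \<lhd> ?H\<lparr>carrier := ?\<Gamma> i\<rparr>" for i
  proof -
    have "?\<Gamma> (i + 1) = null_classes Y (?W (i + 1)) \<inter> ?\<Gamma> i"
      using null_classes_mono[of "?W i" "?W (i + 1)" Y] unfolding W_Suc by blast
    then show ?thesis
      using H.normal_Int_subgroup[OF H.subgroups_Inter_pair[OF sub sub] null_classes_normal] by simp
  qed
  moreover have "A \<otimes>\<^bsub>?H\<^esub> B \<otimes>\<^bsub>?H\<^esub> inv\<^bsub>?H\<^esub> A \<otimes>\<^bsub>?H\<^esub> inv\<^bsub>?H\<^esub> B \<in> ?\<Gamma> (i + 1)"
    if i: "i \<in> {1..n}" and A: "A \<in> null_classes Y D" and B: "B \<in> ?\<Gamma> i" for i A B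
  proof -
    have "openin Y (?W i)"
      using U i by (intro openin_Union) auto
    then have "A \<otimes>\<^bsub>?H\<^esub> B \<otimes>\<^bsub>?H\<^esub> inv\<^bsub>?H\<^esub> A \<otimes>\<^bsub>?H\<^esub> inv\<^bsub>?H\<^esub> B \<in> null_classes Y (?W (i + 1))"
      unfolding W_Suc using i A B null[of i] U[of i]
      by (intro commutator_in_null_classes_union Y G) auto
    moreover have "A \<otimes>\<^bsub>?H\<^esub> B \<otimes>\<^bsub>?H\<^esub> inv\<^bsub>?H\<^esub> A \<otimes>\<^bsub>?H\<^esub> inv\<^bsub>?H\<^esub> B \<in> null_classes Y D"
      using A B by (intro subgroup.m_closed[OF sub] subgroup.m_inv_closed[OF sub]) auto
    ultimately show ?thesis by blast
  qed
  ultimately show ?thesis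
    unfolding is_central_series_def by (simp add: H.m_inv_consistent[OF sub])
qed

text \<open>Nullhomotopic maps on the diagonal may contract to any point of \<open>G\<close>; path-connectedness moves that
  point to \<open>e\<close>.\<close>

lemma diagonal_null_group_eq:
  assumes "path_connected_space G"
  shows "diagonal_null_group m (X :: 'a topology) G \<mu> e = (homotopy_group (cartesian_power m X) G \<mu> e)
           \<lparr>carrier := null_classes (cartesian_power m X) (diagonal m X)\<rparr>"
proof -
  have "nullhomotopic_on Y D G f \<longleftrightarrow> homotopic_maps (subtopology Y D) G f (\<lambda>_. e)"
    for Y :: "(nat \<Rightarrow> 'a) topology" and D f
    unfolding nullhomotopic_on_def
    using homotopic_with_trans[OF _ homotopic_maps_constant[OF assms _ unit_in_space]] unit_in_space
    by blast
  then show ?thesis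
    by (simp add: diagonal_null_group_def null_classes_def)
qed

end

lemma metrizable_cartesian_power:
  "metrizable_space X \<Longrightarrow> metrizable_space (cartesian_power m X)"
  unfolding metrizable_space_product_topology
  by (auto intro: countable_subset[of _ "{1..m}"])

lemma finite_Inf_attained:
  assumes "Inf S = enat N"
  shows "enat N \<in> S"
proof -
  have "S \<noteq> {}"
    using assms by (auto simp: Inf_enat_def)
  then have "(LEAST x. x \<in> S) \<in> S"
    by (metis LeastI ex_in_conv)
  with assms \<open>S \<noteq> {}\<close> show ?thesis
    by (simp add: Inf_enat_def)
qed

theorem theorem8p2:
  fixes m :: nat and t :: "nat \<Rightarrow> real"
    and X :: "'a topology" and G :: "'b topology"
    and \<mu> :: "'b \<times> 'b \<Rightarrow> 'b" and e :: 'b and \<eta> :: "'b \<Rightarrow> 'b"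
  assumes "m \<ge> 2"
    and "t 1 = 0" and "t m = 1" and "strict_mono_on {1..m} t"
    and "group_like_space G \<mu> e \<eta>" and "path_connected_space G"
    and "metrizable_ANR X"
  shows "group (diagonal_null_group m X G \<mu> e) \<and>
    (sequential_TC m t X \<noteq> \<infinity> \<longrightarrow> nilpotent_group (diagonal_null_group m X G \<mu> e)) \<and>
    nilpotency_class (diagonal_null_group m X G \<mu> e) \<le> sequential_TC m t X"
proof -
  interpret group_like G \<mu> e \<eta> by (rule group_like.intro) fact
  let ?Y = "cartesian_power m X" and ?D = "diagonal m X"
  let ?H = "diagonal_null_group m X G \<mu> e"
  have H: "?H = (homotopy_group ?Y G \<mu> e)\<lparr>carrier := null_classes ?Y ?D\<rparr>"
    by (rule diagonal_null_group_eq) fact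
  have group: "group ?H"
    unfolding H
    by (intro group.subgroup_imp_group group_homotopy_group normal_imp_subgroup null_classes_normal)
  have Y: "metrizable_space ?Y"
    using \<open>metrizable_ANR X\<close> by (intro metrizable_cartesian_power) (simp add: metrizable_ANR_def)
  have t: "t i \<in> {0..1}" if "i \<in> {1..m}" for i
    using strict_mono_on_leD[OF \<open>strict_mono_on {1..m} t\<close>, of 1 i]
      strict_mono_on_leD[OF \<open>strict_mono_on {1..m} t\<close>, of i m] that \<open>t 1 = 0\<close> \<open>t m = 1\<close> by auto
  have series: "\<exists>\<Gamma>. is_central_series ?H n \<Gamma>"
    if U: "\<forall>i\<le>n. openin ?Y (U i) \<and> has_motion_section m t X (U i)"
      and cover: "(\<Union>i\<le>n. U i) = topspace ?Y" for n and U :: "nat \<Rightarrow> (nat \<Rightarrow> 'a) set"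
  proof -
    have null: "null_classes ?Y ?D \<subseteq> null_classes ?Y (U i)" if i: "i \<le> n" for i
    proof -
      have "openin ?Y (U i)" and planner: "has_motion_section m t X (U i)"
        using U i by auto
      then have "U i \<subseteq> topspace ?Y"
        by (intro openin_subset)
      note nullhomotopic_on_motion_domain[OF this planner t, of G _ e]
      then show ?thesis
        unfolding null_classes_def by blast
    qed
    have "is_central_series ?H n (\<lambda>i. null_classes ?Y ?D \<inter> null_classes ?Y (\<Union>j<i. U j))"
      unfolding H
      by (rule central_series_of_open_cover[OF Y \<open>path_connected_space G\<close> _ cover null]) (use U in auto)
    then show ?thesis by blast
  qed
  show ?thesis
  proof (cases "sequential_TC m t X")
    case infinity
    with group show ?thesis by simp
  next
    case (enat N)
    then obtain U :: "nat \<Rightarrow> (nat \<Rightarrow> 'a) set"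
      where "\<forall>i\<le>N. openin ?Y (U i) \<and> has_motion_section m t X (U i)" "(\<Union>i\<le>N. U i) = topspace ?Y"
      using finite_Inf_attained[OF enat[unfolded sequential_TC_def]] by blast
    then obtain \<Gamma> where \<Gamma>: "is_central_series ?H N \<Gamma>"
      using series by blast
    then have "nilpotency_class ?H \<le> enat N"
      unfolding nilpotency_class_def by (intro Inf_lower) auto
    with \<Gamma> group show ?thesis
      unfolding enat nilpotent_group_def by auto
  qed
qed

end
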